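(* Let $M$ be a real symmetric $d\times d$ matrix, $J$ a constant real skew-symmetric $d\times d$ matrix, and $U:\mathbb{R}^d\to\mathbb{R}$ a cubic polynomial. Let $\bar U:\mathbb{R}^d\times\mathbb{R}^d\to\mathbb{R}$ be a quadratic polarization of $U$ and let $\overline{\nabla}\bar U$ be a polarized discrete gradient for $\bar U$. Let $h>0$ and let $(y_n)_{n\ge 0}$ be a sequence in $\mathbb{R}^d$ satisfying, for all $n\ge 0$, the scheme $$y_{n+2}=\exp(2hJM)\,y_n+2h\,\phi(2hJM)\,J\,\overline{\nabla}\bar U(y_n,y_{n+1},y_{n+2}).$$ Then the scheme preserves the polarized energy $$\bar H(y_n,y_{n+1})=\tfrac14\left(y_n^TMy_n+y_{n+1}^TMy_{n+1}\right)+\bar U(y_n,y_{n+1}),$$ that is, $\bar H(y_{n+1},y_{n+2})=\bar H(y_n,y_{n+1})$ for all $n\ge 0$.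
   Context: The scheme is a numerical method with step size $h$ for the system $\dot y=J\nabla H(y)=JMy+J\nabla U(y)$ with $H(y)=\frac12y^TMy+U(y)$. $\phi$ is the entire function $\phi(z)=\frac{e^z-1}{z}$ (with $\phi(0)=1$), and for a square matrix $V$, $\phi(V)=\sum_{k\ge0}\frac{V^k}{(k+1)!}$. A quadratic polarization of $U$ (in two arguments) is a polynomial function $\bar U(x,y)$, of degree at most two in each of the vector arguments $x,y\in\mathbb{R}^d$, that is consistent with $U$, i.e. $\bar U(x,x)=U(x)$, and invariant under cyclic permutation of its arguments, i.e. $\bar U(x,y)=\bar U(y,x)$. A polarized discrete gradient for $\bar U$ is a map $\overline{\nabla}\bar U:(\mathbb{R}^d)^3\to\mathbb{R}^d$ such that for all $x,y,z\in\mathbb{R}^d$: $$\bar U(y,z)-\bar U(x,y)=\tfrac12(z-x)^T\,\overline{\nabla}\bar U(x,y,z),\qquad \overline{\nabla}\bar U(x,x,x)=\nabla U(x).$$ *)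

theory Defs
  imports "HOL-Analysis.Analysis"
begin

text \<open>
  Polynomial functions on \<open>\<real>\<^sup>d\<close> with a degree bound, written out in the monomial basis.
  A multi-index is a function \<open>'d \<Rightarrow> nat\<close>.
\<close>

definition multi_indices :: "nat \<Rightarrow> ('d::finite \<Rightarrow> nat) set" where
  "multi_indices k = {\<alpha>. (\<Sum>i\<in>UNIV. \<alpha> i) \<le> k}"

lemma finite_multi_indices: "finite (multi_indices k :: ('d::finite \<Rightarrow> nat) set)"
proof (rule finite_subset)
  show "(multi_indices k :: ('d \<Rightarrow> nat) set) \<subseteq> (UNIV \<rightarrow>\<^sub>E {..k})"
  proof
    fix \<alpha> :: "'d \<Rightarrow> nat" assume "\<alpha> \<in> multi_indices k"
    then have "(\<Sum>i\<in>UNIV. \<alpha> i) \<le> k" by (simp add: multi_indices_def)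
    moreover have "\<alpha> i \<le> (\<Sum>i\<in>UNIV. \<alpha> i)" for i by (rule member_le_sum) auto
    ultimately show "\<alpha> \<in> UNIV \<rightarrow>\<^sub>E {..k}" by (auto intro: order_trans)
  qed
  show "finite (UNIV \<rightarrow>\<^sub>E {..k} :: ('d \<Rightarrow> nat) set)" by (intro finite_PiE) auto
qed

definition monomial_at :: "('d::finite \<Rightarrow> nat) \<Rightarrow> real ^ 'd \<Rightarrow> real" where
  "monomial_at \<alpha> x = (\<Prod>i\<in>UNIV. (x $ i) ^ \<alpha> i)"

definition polynomial_deg_le :: "nat \<Rightarrow> (real ^ 'd \<Rightarrow> real) \<Rightarrow> bool" where
  "polynomial_deg_le k f \<longleftrightarrow>
     (\<exists>c. \<forall>x. f x = (\<Sum>\<alpha>\<in>multi_indices k. c \<alpha> * monomial_at \<alpha> x))"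

text \<open>Polynomial in the pair \<open>(x, y)\<close>, of degree at most \<open>k\<close> in \<open>x\<close> and at most \<open>k\<close> in \<open>y\<close>.\<close>

definition polynomial2_deg_le :: "nat \<Rightarrow> (real ^ 'd \<Rightarrow> real ^ 'd \<Rightarrow> real) \<Rightarrow> bool" where
  "polynomial2_deg_le k f \<longleftrightarrow>
     (\<exists>c. \<forall>x y. f x y = (\<Sum>\<alpha>\<in>multi_indices k. \<Sum>\<beta>\<in>multi_indices k.
        c \<alpha> \<beta> * monomial_at \<alpha> x * monomial_at \<beta> y))"

definition quadratic_polarization ::
    "(real ^ 'd \<Rightarrow> real) \<Rightarrow> (real ^ 'd \<Rightarrow> real ^ 'd \<Rightarrow> real) \<Rightarrow> bool" where
  "quadratic_polarization U Ubar \<longleftrightarrow>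
     polynomial2_deg_le 2 Ubar \<and>
     (\<forall>x. Ubar x x = U x) \<and>
     (\<forall>x y. Ubar x y = Ubar y x)"

definition polarized_discrete_gradient ::
    "(real ^ 'd \<Rightarrow> real) \<Rightarrow> (real ^ 'd \<Rightarrow> real ^ 'd \<Rightarrow> real) \<Rightarrow>
     (real ^ 'd \<Rightarrow> real ^ 'd \<Rightarrow> real ^ 'd \<Rightarrow> real ^ 'd) \<Rightarrow> bool" where
  "polarized_discrete_gradient U Ubar G \<longleftrightarrow>
     (\<forall>x y z. Ubar y z - Ubar x y = 1 / 2 * ((z - x) \<bullet> G x y z)) \<and>
     (\<forall>x. GDERIV U x :> G x x x)"

text \<open>
  The type \<open>real ^ 'd ^ 'd\<close> carries componentwise multiplication, so the class-based
  \<open>(^)\<close> and \<open>exp\<close> do not give matrix powers and the matrix exponential.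
\<close>

primrec matrix_power :: "real ^ 'd ^ 'd \<Rightarrow> nat \<Rightarrow> real ^ 'd ^ 'd" where
  "matrix_power V 0 = mat 1"
| "matrix_power V (Suc k) = V ** matrix_power V k"

definition matrix_exp :: "real ^ 'd ^ 'd \<Rightarrow> real ^ 'd ^ 'd" where
  "matrix_exp V = (\<Sum>k. (1 / fact k) *\<^sub>R matrix_power V k)"

text \<open>The function \<open>\<phi>(z) = (exp z - 1) / z\<close> at a matrix, through its power series at \<open>0\<close>.\<close>

definition matrix_phi :: "real ^ 'd ^ 'd \<Rightarrow> real ^ 'd ^ 'd" where
  "matrix_phi V = (\<Sum>k. (1 / fact (k + 1)) *\<^sub>R matrix_power V k)"

definition polarized_energy ::
    "real ^ 'd ^ 'd \<Rightarrow> (real ^ 'd \<Rightarrow> real ^ 'd \<Rightarrow> real) \<Rightarrow> real ^ 'd \<Rightarrow> real ^ 'd \<Rightarrow> real" where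
  "polarized_energy M Ubar x y = 1 / 4 * (x \<bullet> (M *v x) + y \<bullet> (M *v y)) + Ubar x y"

end

theory Submission
  imports Defs
begin

text \<open>
  Fix \<open>x = y\<^sub>n\<close> and freeze the value \<open>g\<close> of the discrete gradient. Then \<open>y\<^bsub>n+2\<^esub>\<close> is the
  exact solution at time \<open>2h\<close> of the linear Hamiltonian equation \<open>u' = J (M u + g)\<close>, \<open>u(0) = x\<close>.
  Skew symmetry of \<open>J\<close> makes \<open>1/2 u\<^sup>T M u + g\<^sup>T u\<close> constant along this solution, so half of its
  quadratic part changes by \<open>-1/2 (y\<^bsub>n+2\<^esub> - y\<^sub>n)\<^sup>T g\<close> from \<open>y\<^sub>n\<close> to \<open>y\<^bsub>n+2\<^esub>\<close>. The discrete gradient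
  property says that this cancels the change of the polarized potential.
\<close>

text \<open>Since \<open>**\<close> is not the multiplication of a type class, this is what lets it
  pass through infinite series and scalars and what bounds the norm of a product.\<close>

lemma bounded_bilinear_matrix_mult:
  "bounded_bilinear ((**) :: real ^ 'd ^ 'd \<Rightarrow> real ^ 'd ^ 'd \<Rightarrow> real ^ 'd ^ 'd)"
  unfolding bilinear_conv_bounded_bilinear[symmetric] bilinear_def
  by (auto intro!: linearI simp: matrix_add_ldistrib matrix_scalar_ac
      scalar_matrix_assoc[symmetric])
    (simp add: matrix_matrix_mult_def vec_eq_iff distrib_right sum.distrib)

lemma bounded_linear_matrix_vector_mult_left:
  "bounded_linear (\<lambda>A :: real ^ 'd ^ 'd. A *v v)"
  unfolding linear_conv_bounded_linear[symmetric]
  by (auto intro!: linearI simp: matrix_vector_mult_add_rdistrib scaleR_matrix_vector_assoc)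

lemma matrix_power_scaleR: "matrix_power (s *\<^sub>R A) k = s ^ k *\<^sub>R matrix_power A k"
  by (induction k)
    (simp_all add: bounded_bilinear.scaleR_left[OF bounded_bilinear_matrix_mult]
      bounded_bilinear.scaleR_right[OF bounded_bilinear_matrix_mult] mult_ac)

text \<open>Each product costs a constant factor \<open>K\<close>. Absorbing it into the ratio
  \<open>r = norm A * K\<close> keeps the bound geometric, so the factorials in both matrix series
  dominate it.\<close>

lemma norm_matrix_power_bound:
  fixes A :: "real ^ 'd ^ 'd"
  obtains C r where "\<And>k. norm (matrix_power A k) \<le> C * r ^ k" "r \<ge> 0" "C \<ge> 0"
proof -
  obtain K where K: "K > 0" "\<And>B C. norm ((B :: real ^ 'd ^ 'd) ** (C :: real ^ 'd ^ 'd)) \<le> norm B * norm C * K"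
    using bounded_bilinear.pos_bounded[OF bounded_bilinear_matrix_mult] by blast
  define r where "r = norm A * K"
  have r: "r \<ge> 0" using K by (simp add: r_def)
  have "norm (matrix_power A k) \<le> norm (mat 1 :: real ^ 'd ^ 'd) * r ^ k" for k
  proof (induction k)
    case (Suc k)
    have "norm (matrix_power A (Suc k)) \<le> r * norm (matrix_power A k)"
      using K(2)[of A "matrix_power A k"] by (simp add: r_def mult_ac)
    also have "\<dots> \<le> r * (norm (mat 1 :: real ^ 'd ^ 'd) * r ^ k)"
      using Suc r by (rule mult_left_mono)
    finally show ?case by (simp add: mult_ac)
  qed simp
  then show thesis using r by (rule that) simp
qed

lemma summable_matrix_exp:
  fixes A :: "real ^ 'd ^ 'd"
  shows "summable (\<lambda>k. (1 / fact k) *\<^sub>R matrix_power A k)"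
proof -
  obtain C r where C: "\<And>k. norm (matrix_power A k) \<le> C * r ^ k" "r \<ge> 0" "C \<ge> 0"
    using norm_matrix_power_bound by blast
  show ?thesis
  proof (rule summable_comparison_test')
    show "summable (\<lambda>k. C * (inverse (fact k) * r ^ k))"
      by (intro summable_mult summable_exp)
    show "norm ((1 / fact k) *\<^sub>R matrix_power A k) \<le> C * (inverse (fact k) * r ^ k)" for k
      using C(1)[of k] by (simp add: field_simps)
  qed
qed

lemma summable_matrix_phi:
  fixes A :: "real ^ 'd ^ 'd"
  shows "summable (\<lambda>k. (1 / fact (k + 1)) *\<^sub>R matrix_power A k)"
proof -
  obtain C r where C: "\<And>k. norm (matrix_power A k) \<le> C * r ^ k" "r \<ge> 0" "C \<ge> 0"
    using norm_matrix_power_bound by blast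
  show ?thesis
  proof (rule summable_comparison_test')
    show "summable (\<lambda>k. C * (inverse (fact k) * r ^ k))"
      by (intro summable_mult summable_exp)
    show "norm ((1 / fact (k + 1)) *\<^sub>R matrix_power A k) \<le> C * (inverse (fact k) * r ^ k)" for k
    proof -
      have "norm ((1 / fact (k + 1)) *\<^sub>R matrix_power A k)
          \<le> (1 / fact (k + 1)) * (C * r ^ k)"
        using C(1)[of k] by (simp add: divide_right_mono del: fact_Suc)
      also have "\<dots> \<le> (1 / fact k) * (C * r ^ k)"
        using C by (intro mult_right_mono divide_left_mono fact_mono) auto
      finally show ?thesis by (simp add: field_simps)
    qed
  qed
qed

text \<open>This is exp(z) = 1 + z phi(z), obtained by splitting off the term of index 0 and pulling
  one factor \<open>V\<close> out of the rest. No division occurs, so \<open>V\<close> may be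
  singular.\<close>

lemma matrix_exp_eq_phi: "matrix_exp V = mat 1 + V ** matrix_phi V"
proof -
  have "matrix_exp V = mat 1 + (\<Sum>k. (1 / fact (Suc k)) *\<^sub>R matrix_power V (Suc k))"
    unfolding matrix_exp_def using suminf_split_head[OF summable_matrix_exp[of V]] by simp
  also have "(\<Sum>k. (1 / fact (Suc k)) *\<^sub>R matrix_power V (Suc k)) = V ** matrix_phi V"
    unfolding matrix_phi_def
    by (subst bounded_linear.suminf[OF
          bounded_bilinear.bounded_linear_right[OF bounded_bilinear_matrix_mult]
          summable_matrix_phi])
      (simp add: bounded_bilinear.scaleR_right[OF bounded_bilinear_matrix_mult])
  finally show ?thesis .
qed

text \<open>Taking the inner product with a basis vector turns the series into a real power series,
  where termwise differentiation is available. Summability of both vector series allows the inner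
  product to move inside the sums.\<close>

lemma has_vector_derivative_power_series:
  fixes c :: "nat \<Rightarrow> 'a :: euclidean_space"
  assumes "\<And>s :: real. summable (\<lambda>k. s ^ k *\<^sub>R c k)"
    and "\<And>s :: real. summable (\<lambda>k. s ^ k *\<^sub>R (real (Suc k) *\<^sub>R c (Suc k)))"
  shows "((\<lambda>s. \<Sum>k. s ^ k *\<^sub>R c k) has_vector_derivative
           (\<Sum>k. s ^ k *\<^sub>R (real (Suc k) *\<^sub>R c (Suc k)))) (at s)"
proof -
  have inner_suminf: "(\<Sum>k. f k) \<bullet> b = (\<Sum>k. f k \<bullet> b)" and summable_inner: "summable (\<lambda>k. f k \<bullet> b)"
    if "summable f" for f :: "nat \<Rightarrow> 'a" and b
    using that by (simp_all add: bounded_linear.suminf[OF bounded_linear_inner_left]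
        bounded_linear.summable[OF bounded_linear_inner_left])
  have "((\<lambda>s. (\<Sum>k. s ^ k *\<^sub>R c k) \<bullet> b) has_field_derivative
           (\<Sum>k. s ^ k *\<^sub>R (real (Suc k) *\<^sub>R c (Suc k))) \<bullet> b) (at s)" for b
  proof -
    have "((\<lambda>s. \<Sum>k. (c k \<bullet> b) * s ^ k) has_field_derivative
             (\<Sum>k. diffs (\<lambda>k. c k \<bullet> b) k * s ^ k)) (at s)"
      using summable_inner[OF assms(1), of _ b]
      by (intro termdiffs_strong_converges_everywhere) (simp add: mult_ac)
    then show ?thesis
      by (simp add: inner_suminf[OF assms(1)] inner_suminf[OF assms(2)] diffs_def mult_ac
          del: scaleR_scaleR of_nat_Suc)
  qed
  then show ?thesis
    unfolding has_vector_derivative_def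
    by (subst has_derivative_componentwise_within)
      (simp add: has_field_derivative_def mult_commute_abs)
qed

text \<open>As a power series in \<open>s\<close>, the function is the sum of
  \<open>s ^ (k + 1) / fact (k + 1)\<close> times the \<open>k\<close>-th power of \<open>A\<close>;
  differentiating termwise gives the exponential series.\<close>

lemma has_vector_derivative_scaleR_matrix_phi:
  fixes A :: "real ^ 'd ^ 'd"
  shows "((\<lambda>s. s *\<^sub>R matrix_phi (s *\<^sub>R A)) has_vector_derivative matrix_exp (s *\<^sub>R A)) (at s)"
proof -
  \<comment> \<open>The outer factor \<open>s\<close> shifts the series by one index, so the
    coefficient at 0 is 0.\<close>
  define c where "c k = (case k of 0 \<Rightarrow> 0 | Suc j \<Rightarrow> (1 / fact (j + 1)) *\<^sub>R matrix_power A j)" for k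
  have c: "c 0 = 0" "\<And>k. c (Suc k) = (1 / fact (k + 1)) *\<^sub>R matrix_power A k"
    by (simp_all add: c_def)
  have diff_c: "real (Suc k) *\<^sub>R c (Suc k) = (1 / fact k) *\<^sub>R matrix_power A k" for k
    by (simp add: c field_simps del: of_nat_Suc)
  have phi_sums: "(\<lambda>k. s ^ k *\<^sub>R c k) sums (s *\<^sub>R matrix_phi (s *\<^sub>R A))" for s
  proof -
    have "(\<lambda>k. s *\<^sub>R ((1 / fact (k + 1)) *\<^sub>R matrix_power (s *\<^sub>R A) k)) sums
        (s *\<^sub>R matrix_phi (s *\<^sub>R A))"
      unfolding matrix_phi_def by (intro sums_scaleR_right summable_sums summable_matrix_phi)
    then have "(\<lambda>k. s ^ Suc k *\<^sub>R c (Suc k)) sums (s *\<^sub>R matrix_phi (s *\<^sub>R A))"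
      by (simp add: c matrix_power_scaleR mult_ac del: fact_Suc)
    then show ?thesis
      using sums_Suc_iff[of "\<lambda>k. s ^ k *\<^sub>R c k"] by (simp add: c)
  qed
  have exp_sums: "(\<lambda>k. s ^ k *\<^sub>R (real (Suc k) *\<^sub>R c (Suc k))) sums matrix_exp (s *\<^sub>R A)" for s
    using summable_sums[OF summable_matrix_exp[of "s *\<^sub>R A"]]
    unfolding diff_c matrix_exp_def by (simp add: matrix_power_scaleR mult_ac)
  show ?thesis
    using has_vector_derivative_power_series[OF sums_summable[OF phi_sums] sums_summable[OF exp_sums]]
    unfolding sums_unique[OF phi_sums, symmetric] sums_unique[OF exp_sums, symmetric] .
qed

lemma skew_symmetric_quadratic_zero:
  fixes J :: "real ^ 'd ^ 'd"
  assumes "transpose J = - J"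
  shows "w \<bullet> (J *v w) = 0"
proof -
  have "w \<bullet> (J *v w) = (transpose J *v w) \<bullet> w"
    by (simp add: dot_lmul_matrix transpose_matrix_vector)
  also have "transpose J *v w = - (J *v w)"
    unfolding assms by (simp add: matrix_vector_mult_def vec_eq_iff sum_negf)
  finally show ?thesis by (simp add: inner_commute)
qed

text \<open>The function \<open>1 / 2 * (u \<bullet> (M *v u)) + g \<bullet> u\<close> has gradient
  \<open>w = M *v u + g\<close>, and the flow moves \<open>u\<close> in direction
  \<open>J *v w\<close>. Its rate of change is therefore \<open>w \<bullet> (J *v w)\<close>, which
  vanishes because \<open>J\<close> is skew.\<close>

lemma exponential_step_energy:
  fixes M J :: "real ^ 'd ^ 'd" and x g :: "real ^ 'd" and t :: real
  assumes M: "transpose M = M" and J: "transpose J = - J"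
  defines "z \<equiv> matrix_exp (t *\<^sub>R (J ** M)) *v x
                + t *\<^sub>R (matrix_phi (t *\<^sub>R (J ** M)) *v (J *v g))"
  shows "1 / 2 * (z \<bullet> (M *v z)) + g \<bullet> z = 1 / 2 * (x \<bullet> (M *v x)) + g \<bullet> x"
proof -
  define A where "A = J ** M"
  define S where "S s = s *\<^sub>R matrix_phi (s *\<^sub>R A)" for s
  define E where "E s = matrix_exp (s *\<^sub>R A)" for s
  have E: "E s = mat 1 + A ** S s" for s
    unfolding E_def S_def matrix_exp_eq_phi
    by (simp add: bounded_bilinear.scaleR_left[OF bounded_bilinear_matrix_mult]
        bounded_bilinear.scaleR_right[OF bounded_bilinear_matrix_mult])
  have S: "(S has_vector_derivative E s) (at s)" for s
    unfolding S_def E_def by (rule has_vector_derivative_scaleR_matrix_phi)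
  define u where "u s = E s *v x + S s *v (J *v g)" for s
  \<comment> \<open>With \<open>E\<close> eliminated, \<open>S\<close> is the only factor that
    depends on \<open>s\<close>, so its derivative suffices.\<close>
  have u_eq: "u s = x + A *v (S s *v x) + S s *v (J *v g)" for s
    by (simp add: u_def E matrix_vector_mult_add_rdistrib matrix_vector_mul_assoc)
  have SV: "((\<lambda>s. S s *v v) has_vector_derivative E s *v v) (at s)" for v s
    using bounded_linear.has_vector_derivative[OF bounded_linear_matrix_vector_mult_left S] .
  have u_deriv: "(u has_vector_derivative J *v (M *v u s + g)) (at s)" for s
  proof -
    have "(u has_vector_derivative 0 + A *v (E s *v x) + E s *v (J *v g)) (at s)"
      unfolding u_eq[abs_def]
      by (intro has_vector_derivative_add has_vector_derivative_const SV
          bounded_linear.has_vector_derivative[OF matrix_vector_mul_bounded_linear])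
    \<comment> \<open>Expanding \<open>E s\<close> in front of \<open>J *v g\<close> yields
      \<open>J *v g\<close> plus \<open>A *v (S s *v (J *v g))\<close>; the latter combines with
      \<open>A *v (E s *v x)\<close> to \<open>A *v u s\<close>.\<close>
    also have "0 + A *v (E s *v x) + E s *v (J *v g) = A *v u s + J *v g"
      by (simp add: u_def E[of s] matrix_vector_mult_add_rdistrib matrix_vector_right_distrib
          matrix_vector_mul_assoc[symmetric])
    also have "\<dots> = J *v (M *v u s + g)"
      by (simp add: A_def matrix_vector_right_distrib matrix_vector_mul_assoc)
    finally show ?thesis .
  qed
  have M_self_adjoint: "v \<bullet> (M *v w) = w \<bullet> (M *v v)" for v w
    by (metis M dot_lmul_matrix inner_commute transpose_matrix_vector)
  define F where "F s = 1 / 2 * (u s \<bullet> (M *v u s)) + g \<bullet> u s" for s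
  have "(F has_real_derivative 0) (at s)" for s
  proof -
    let ?w = "M *v u s + g"
    have u': "(u has_derivative (\<lambda>r. r *\<^sub>R (J *v ?w))) (at s)"
      using u_deriv by (simp add: has_vector_derivative_def)
    have "(F has_derivative (\<lambda>r. 1 / 2 * (u s \<bullet> (M *v (r *\<^sub>R (J *v ?w))) + (r *\<^sub>R (J *v ?w)) \<bullet> (M *v u s))
        + g \<bullet> (r *\<^sub>R (J *v ?w)))) (at s)"
      unfolding F_def[abs_def]
      by (intro has_derivative_add has_derivative_mult_right has_derivative_inner
          has_derivative_inner_right u'
          bounded_linear.has_derivative[OF matrix_vector_mul_bounded_linear])
    moreover have "1 / 2 * (u s \<bullet> (M *v (r *\<^sub>R (J *v ?w))) + (r *\<^sub>R (J *v ?w)) \<bullet> (M *v u s))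
        + g \<bullet> (r *\<^sub>R (J *v ?w)) = 0 * r" for r
    proof -
      \<comment> \<open>Symmetry of \<open>M\<close> makes the two terms of the product rule equal,
        which cancels the factor \<open>1 / 2\<close>.\<close>
      have "1 / 2 * (u s \<bullet> (M *v (r *\<^sub>R (J *v ?w))) + (r *\<^sub>R (J *v ?w)) \<bullet> (M *v u s))
        + g \<bullet> (r *\<^sub>R (J *v ?w)) = r * (?w \<bullet> (J *v ?w))"
        by (subst M_self_adjoint)
          (simp add: inner_add_left inner_commute[of "J *v ?w"] distrib_left)
      then show ?thesis by (simp add: skew_symmetric_quadratic_zero[OF J])
    qed
    ultimately show ?thesis unfolding has_field_derivative_def by (simp only:)
  qed
  then have "F t = F 0" by (intro DERIV_isconst_all) blast
  moreover have "u 0 = x" by (simp add: u_eq S_def)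
  moreover have "u t = z"
    by (simp add: u_def z_def S_def E_def A_def scaleR_matrix_vector_assoc)
  ultimately show ?thesis by (simp add: F_def)
qed

theorem theorem1:
  fixes M J :: "real ^ 'd ^ 'd"
    and U :: "real ^ 'd \<Rightarrow> real"
    and Ubar :: "real ^ 'd \<Rightarrow> real ^ 'd \<Rightarrow> real"
    and G :: "real ^ 'd \<Rightarrow> real ^ 'd \<Rightarrow> real ^ 'd \<Rightarrow> real ^ 'd"
    and h :: real
    and y :: "nat \<Rightarrow> real ^ 'd"
  assumes M_symmetric: "transpose M = M"
    and J_skew: "transpose J = - J"
    and U_cubic: "polynomial_deg_le 3 U"
    and polarization: "quadratic_polarization U Ubar"
    and discrete_gradient: "polarized_discrete_gradient U Ubar G"
    and h_pos: "h > 0"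
    and scheme: "\<And>n. y (n + 2) =
        matrix_exp ((2 * h) *\<^sub>R (J ** M)) *v y n
        + (2 * h) *\<^sub>R (matrix_phi ((2 * h) *\<^sub>R (J ** M)) *v (J *v G (y n) (y (n + 1)) (y (n + 2))))"
  shows "\<forall>n. polarized_energy M Ubar (y (n + 1)) (y (n + 2)) = polarized_energy M Ubar (y n) (y (n + 1))"
proof
  fix n
  define g where "g = G (y n) (y (n + 1)) (y (n + 2))"
  have potential: "Ubar (y (n + 1)) (y (n + 2)) - Ubar (y n) (y (n + 1))
      = 1 / 2 * ((y (n + 2) - y n) \<bullet> g)"
    using discrete_gradient by (simp add: g_def polarized_discrete_gradient_def)
  have "1 / 2 * (y (n + 2) \<bullet> (M *v y (n + 2))) + g \<bullet> y (n + 2)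
      = 1 / 2 * (y n \<bullet> (M *v y n)) + g \<bullet> y n"
    using exponential_step_energy[OF M_symmetric J_skew, of "2 * h" "y n" g]
    unfolding g_def scheme[of n, symmetric] .
  \<comment> \<open>The quadratic term of \<open>y (n + 1)\<close> occurs in both energies and
    cancels. Half of the last identity supplies the remaining quadratic terms with their weight
    \<open>1 / 4\<close>, and its terms in \<open>g\<close> match \<open>potential\<close>.\<close>
  with potential
  show "polarized_energy M Ubar (y (n + 1)) (y (n + 2)) = polarized_energy M Ubar (y n) (y (n + 1))"
    unfolding polarized_energy_def inner_diff_left inner_commute[of g] by argo
qed

end
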